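(* Let $D\subsetneq\mathbb{R}^n$ be an open set with $\partial D\neq\emptyset$, let $L\ge 1$, and let $f:D\to fD\subsetneq\mathbb{R}^n$ be a sense-preserving homeomorphism onto its image $fD$ satisfying the $L$-bilipschitz condition with respect to the $\tilde c$ metric, i.e. $$\frac{\tilde c_D(x,y)}{L}\le\tilde c_{fD}(f(x),f(y))\le L\,\tilde c_D(x,y)\quad\text{for all }x,y\in D.$$ Then $f$ is quasiconformal with linear dilatation $H(f)\le L^2$.
   Context: For an open set $G\subsetneq\mathbb{R}^n$ with $\partial G\ne\emptyset$ and $x,y\in G$, $\tilde c_G(x,y)=\sup_{p\in\partial G}\frac{|x-y|}{\max\{|x-p|,|y-p|\}}$. The linear dilatation of $f$ at $z\in D$ is $H(f,z)=\limsup_{|x-z|=|y-z|=r\to0^+}\frac{|f(x)-f(z)|}{|f(y)-f(z)|}$, and $H(f)\le L^2$ means $H(f,z)\le L^2$ for every $z\in D$. Quasiconformality is in the sense of the metric definition: a homeomorphism is quasiconformal if its linear dilatation $H(f,z)$ is uniformly bounded in $z\in D$. *)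

theory Defs
  imports "HOL-Analysis.Analysis" "HOL-Homology.Homology"
begin

text \<open>
  For \<open>G\<close> open with nonempty frontier and \<open>x, y \<in> G\<close> the denominators are positive and, by the
  triangle inequality, at least \<open>dist x y / 2\<close>, so the real-valued supremum is over a nonempty
  set bounded by 2.
\<close>

definition c_tilde :: "'a::metric_space set \<Rightarrow> 'a \<Rightarrow> 'a \<Rightarrow> real" where
  "c_tilde G x y = (SUP p\<in>frontier G. dist x y / max (dist x p) (dist y p))"

text \<open>
  The linear dilatation takes values in the extended reals, as the upper limit may be infinite.
  For \<open>z\<close> in the interior of the domain of \<open>f\<close>, only values of \<open>f\<close> inside the domain matter, since
  small spheres around \<open>z\<close> lie in it.
\<close>

definition linear_dilatation ::
    "('a::real_normed_vector \<Rightarrow> 'b::real_normed_vector) \<Rightarrow> 'a \<Rightarrow> ereal" where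
  "linear_dilatation f z =
     Limsup (at_right 0) (\<lambda>r::real.
       SUP (x, y) \<in> {(x, y). norm (x - z) = r \<and> norm (y - z) = r}.
         ereal (norm (f x - f z) / norm (f y - f z)))"

text \<open>The metric definition of quasiconformality.\<close>

definition quasiconformal_on ::
    "'a::real_normed_vector set \<Rightarrow> ('a \<Rightarrow> 'b::real_normed_vector) \<Rightarrow> bool" where
  "quasiconformal_on D f \<longleftrightarrow>
     (\<exists>g. homeomorphism D (f ` D) f g) \<and>
     (\<exists>K::real. \<forall>z\<in>D. linear_dilatation f z \<le> ereal K)"

text \<open>
  A continuous injective map of an open set \<open>D\<close> of \<open>n\<close>-space is sense-preserving if its local degree
  is 1 at every point \<open>z\<close>, that is, if it carries the local orientation at \<open>z\<close> to the one at
  \<open>f z\<close> determined by the standard orientation. Local orientations are generators of the infinite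
  cyclic groups \<open>H\<^sub>n(D, D - {z})\<close> and \<open>H\<^sub>n(\<real>\<^sup>n, \<real>\<^sup>n - {f z})\<close>; the standard ones correspond under the
  isomorphism induced by the translation taking \<open>z\<close> to \<open>f z\<close>, so local degree 1 means that \<open>f\<close>
  induces the same homomorphism as this translation. Being pointwise, the condition covers every
  component when \<open>D\<close> is not connected.
\<close>

definition sense_preserving_on :: "'a::euclidean_space set \<Rightarrow> ('a \<Rightarrow> 'a) \<Rightarrow> bool" where
  "sense_preserving_on D f \<longleftrightarrow>
     (\<forall>z\<in>D.
        hom_induced (int DIM('a)) (top_of_set D) (D - {z}) euclidean (UNIV - {f z}) f =
        hom_induced (int DIM('a)) (top_of_set D) (D - {z}) euclidean (UNIV - {f z})
          (\<lambda>x. x + (f z - z)))"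

end

theory Submission
  imports Defs
begin

text \<open>
  If \<open>d\<close> is the distance of \<open>z\<close> from the frontier of \<open>G\<close>, then the supremum defining
  \<open>c_tilde G x z\<close> lies between \<open>dist x z / (d + dist x z)\<close> and \<open>dist x z / d\<close>. Applying the lower
  bound at \<open>f x\<close> and \<open>y\<close> and the upper bound at \<open>x\<close> and \<open>f y\<close>, where \<open>x\<close> and \<open>y\<close> both have
  distance \<open>r\<close> from \<open>z\<close>, the bilipschitz condition yields
  \<open>norm (f x - f z) / norm (f y - f z) \<le> L\<^sup>2 (1 + norm (f x - f z) / d') (1 + r / d)\<close>,
  with \<open>d'\<close> the distance of \<open>f z\<close> from the frontier of the image. The last two factors tend to 1
  as \<open>r\<close> tends to 0. The image is open by invariance of domain, so \<open>d'\<close> is positive.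
\<close>

lemma infdist_frontier_pos:
  assumes "open G" "frontier G \<noteq> {}" "z \<in> G"
  shows "infdist z (frontier G) > 0"
proof -
  have "z \<notin> frontier G"
    using assms by (simp add: frontier_def interior_open)
  then show ?thesis
    using assms(2) infdist_pos_not_in_closed[OF frontier_closed] by blast
qed

text \<open>The denominator is at least \<open>dist z p\<close>, hence at least the distance from
  \<open>z\<close> to the frontier. This termwise form serves twice: it bounds the supremum from
  above, and it shows that the family is bounded, as \<open>cSUP_upper\<close> requires for the
  lower bound.\<close>

lemma c_tilde_quotient_le:
  assumes "open G" "frontier G \<noteq> {}" "z \<in> G" "p \<in> frontier G"
  shows "dist x z / max (dist x p) (dist z p) \<le> dist x z / infdist z (frontier G)"
proof (rule divide_left_mono)
  show "infdist z (frontier G) \<le> max (dist x p) (dist z p)"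
    using infdist_le[OF assms(4), of z] by simp
  then show "0 < max (dist x p) (dist z p) * infdist z (frontier G)"
    using infdist_frontier_pos[OF assms(1-3)] by simp
qed simp

lemma c_tilde_le:
  assumes "open G" "frontier G \<noteq> {}" "z \<in> G"
  shows "c_tilde G x z \<le> dist x z / infdist z (frontier G)"
  unfolding c_tilde_def by (intro cSUP_least assms(2) c_tilde_quotient_le assms)

text \<open>A frontier point \<open>p\<close> nearest to \<open>z\<close> is a good enough
  competitor in the supremum: the triangle inequality bounds its denominator by
  \<open>dist z p + dist x z\<close>. Such a \<open>p\<close> exists because the frontier is closed
  and bounded closed sets are compact.\<close>

lemma c_tilde_ge:
  fixes x z :: "'a::heine_borel"
  assumes "open G" "frontier G \<noteq> {}" "z \<in> G"
  shows "dist x z / (infdist z (frontier G) + dist x z) \<le> c_tilde G x z"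
proof -
  obtain p where p: "p \<in> frontier G" "infdist z (frontier G) = dist z p"
    using infdist_attains_inf[OF frontier_closed assms(2)] by blast
  have pos: "dist z p > 0"
    using infdist_frontier_pos[OF assms] p(2) by simp
  have "max (dist x p) (dist z p) \<le> dist z p + dist x z"
    using dist_triangle[of x p z] by simp
  then have "dist x z / (dist z p + dist x z) \<le> dist x z / max (dist x p) (dist z p)"
    using pos by (intro divide_left_mono) (auto simp: add_pos_nonneg less_max_iff_disj)
  also have "\<dots> \<le> c_tilde G x z"
    unfolding c_tilde_def
  proof (rule cSUP_upper[OF p(1)])
    show "bdd_above ((\<lambda>p. dist x z / max (dist x p) (dist z p)) ` frontier G)"
      using c_tilde_quotient_le[OF assms] by (auto intro!: bdd_aboveI2)
  qed
  finally show ?thesis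
    using p(2) by simp
qed

lemma distortion_bound:
  fixes f :: "'a::{real_normed_vector, heine_borel} \<Rightarrow> 'b::{real_normed_vector, heine_borel}"
  assumes "open D" "frontier D \<noteq> {}" "open (f ` D)" "frontier (f ` D) \<noteq> {}"
    and L: "L > 0"
    and lip: "\<And>x y. x \<in> D \<Longrightarrow> y \<in> D \<Longrightarrow>
           c_tilde D x y / L \<le> c_tilde (f ` D) (f x) (f y) \<and>
           c_tilde (f ` D) (f x) (f y) \<le> L * c_tilde D x y"
    and xyz: "x \<in> D" "y \<in> D" "z \<in> D" and r: "norm (x - z) = r" "norm (y - z) = r" "r > 0"
    and ne: "f y \<noteq> f z"
  shows "norm (f x - f z) / norm (f y - f z) \<le>
    L\<^sup>2 * (1 + norm (f x - f z) / infdist (f z) (frontier (f ` D)))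
       * (1 + r / infdist z (frontier D))"
proof -
  define d d' a b where "d = infdist z (frontier D)" and "d' = infdist (f z) (frontier (f ` D))"
    and "a = norm (f x - f z)" and "b = norm (f y - f z)"
  have fz: "f z \<in> f ` D"
    using xyz by blast
  have pos: "d > 0" "d' > 0" "a \<ge> 0" "b > 0"
    using infdist_frontier_pos[OF assms(1,2) xyz(3)] infdist_frontier_pos[OF assms(3,4) fz] ne
    by (auto simp: d_def d'_def a_def b_def)
  have "a / (d' + a) \<le> c_tilde (f ` D) (f x) (f z)"
    using c_tilde_ge[OF assms(3,4) fz] by (simp add: a_def d'_def dist_norm)
  also have "\<dots> \<le> L * c_tilde D x z"
    using lip xyz by blast
  also have "\<dots> \<le> L * (r / d)"
    using mult_left_mono[OF c_tilde_le[OF assms(1,2) xyz(3), of x], of L] L r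
    by (simp add: d_def dist_norm)
  \<comment> \<open>The right side still contains \<open>a\<close>. It is not solved for
    \<open>a\<close>; the surplus survives as the factor \<open>1 + a / d'\<close>, which continuity
    later brings close to 1.\<close>
  finally have A: "a \<le> L * (r / d) * (d' + a)"
    using pos by (simp add: pos_divide_le_eq add_pos_nonneg)
  have "r / (d + r) / L \<le> c_tilde D y z / L"
    using c_tilde_ge[OF assms(1,2) xyz(3), of y] L r
    by (intro divide_right_mono) (simp_all add: d_def dist_norm)
  also have "\<dots> \<le> c_tilde (f ` D) (f y) (f z)"
    using lip xyz by blast
  also have "\<dots> \<le> b / d'"
    using c_tilde_le[OF assms(3,4) fz] by (simp add: b_def d'_def dist_norm)
  finally have "r \<le> L * (d + r) * b / d'"
    using pos L r(3) by (simp add: pos_divide_le_eq ac_simps del: divide_divide_eq_left)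
  then have "r * d' \<le> L * (d + r) * b"
    using pos(2) by (simp add: pos_le_divide_eq)
  \<comment> \<open>The multiplier is chosen so that the left side becomes the bound in
    \<open>A\<close>, which eliminates \<open>r\<close> in favour of \<open>b\<close>.\<close>
  then have "L * (d' + a) / (d * d') * (r * d') \<le> L * (d' + a) / (d * d') * (L * (d + r) * b)"
    using pos L by (intro mult_left_mono) auto
  moreover have "L * (r / d) * (d' + a) = L * (d' + a) / (d * d') * (r * d')"
    using pos by (simp add: field_simps)
  ultimately have "a \<le> L * (d' + a) / (d * d') * (L * (d + r) * b)"
    using A by simp
  also have "\<dots> = L\<^sup>2 * (1 + a / d') * (1 + r / d) * b"
    using pos by (simp add: field_simps power2_eq_square)
  finally show ?thesis
    using pos by (simp add: pos_divide_le_eq flip: a_def b_def d_def d'_def)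
qed

text \<open>Given \<open>e > 0\<close>, all quotients on every sufficiently small sphere around
  \<open>z\<close> are at most \<open>L\<^sup>2 + e\<close>, so their suprema and the upper limit
  obey the same bound.\<close>

lemma linear_dilatation_le:
  fixes f :: "'a::{real_normed_vector, heine_borel} \<Rightarrow> 'b::{real_normed_vector, heine_borel}"
  assumes "open D" "frontier D \<noteq> {}" "open (f ` D)" "frontier (f ` D) \<noteq> {}"
    and L: "L > 0" and cont: "continuous_on D f" and inj: "inj_on f D"
    and lip: "\<And>x y. x \<in> D \<Longrightarrow> y \<in> D \<Longrightarrow>
           c_tilde D x y / L \<le> c_tilde (f ` D) (f x) (f y) \<and>
           c_tilde (f ` D) (f x) (f y) \<le> L * c_tilde D x y"
    and z: "z \<in> D"
  shows "linear_dilatation f z \<le> ereal (L\<^sup>2)"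
proof (rule ereal_le_epsilon2)
  fix e :: real
  assume e: "e > 0"
  define d d' where "d = infdist z (frontier D)" and "d' = infdist (f z) (frontier (f ` D))"
  have pos: "d > 0" "d' > 0"
    using infdist_frontier_pos[OF assms(1,2) z] infdist_frontier_pos[OF assms(3,4) imageI[OF z]]
    by (auto simp: d_def d'_def)
  \<comment> \<open>A single \<open>t\<close> is sought to dominate both
    \<open>norm (f x - f z) / d'\<close> and \<open>r / d\<close>.\<close>
  have "((\<lambda>t. L\<^sup>2 * (1 + t) * (1 + t)) \<longlongrightarrow> L\<^sup>2 * (1 + 0) * (1 + 0)) (at_right 0)"
    by (intro tendsto_intros)
  then have "\<forall>\<^sub>F t in at_right 0. L\<^sup>2 * (1 + t) * (1 + t) < L\<^sup>2 + e"
    using e by (auto elim: order_tendstoD(2))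
  then have "\<forall>\<^sub>F t in at_right 0. t > 0 \<and> L\<^sup>2 * (1 + t) * (1 + t) < L\<^sup>2 + e"
    by (intro eventually_conj eventually_at_right_less)
  then obtain t where t: "t > 0" "L\<^sup>2 * (1 + t) * (1 + t) < L\<^sup>2 + e"
    using eventually_happens' trivial_limit_at_right_real by blast
  have "isCont f z"
    using cont assms(1) z continuous_on_eq_continuous_at by blast
  then obtain s where s: "s > 0" "\<And>x. dist x z < s \<Longrightarrow> dist (f x) (f z) < t * d'"
    using mult_pos_pos[OF t(1) pos(2)] unfolding continuous_at_eps_delta by blast
  obtain u where u: "u > 0" "ball z u \<subseteq> D"
    using assms(1) z openE by blast
  \<comment> \<open>The three bounds on \<open>r\<close> give, in turn, \<open>r / d < t\<close>,
    the continuity estimate for \<open>f\<close>, and that the sphere lies in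
    \<open>D\<close>.\<close>
  have "\<forall>\<^sub>F r in at_right 0. 0 < r \<and> r < min (t * d) (min s u)"
    using t pos s u by (auto simp: eventually_at_right_field intro!: exI[of _ "min (t * d) (min s u)"])
  then have "\<forall>\<^sub>F r in at_right 0.
      (SUP (x, y) \<in> {(x, y). norm (x - z) = r \<and> norm (y - z) = r}.
        ereal (norm (f x - f z) / norm (f y - f z))) \<le> ereal (L\<^sup>2 + e)"
  proof eventually_elim
    case (elim r)
    have "norm (f x - f z) / norm (f y - f z) \<le> L\<^sup>2 + e"
      if xy: "norm (x - z) = r" "norm (y - z) = r" for x y
    proof -
      have D: "x \<in> D" "y \<in> D"
        using u(2) xy elim by (auto simp: subset_iff dist_norm norm_minus_commute)
      have "f y \<noteq> f z"
        using inj_onD[OF inj _ D(2) z] xy elim by auto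
      then have "norm (f x - f z) / norm (f y - f z) \<le>
          L\<^sup>2 * (1 + norm (f x - f z) / d') * (1 + r / d)"
        unfolding d_def d'_def
        using elim by (intro distortion_bound[OF assms(1-5) lip D z xy]) auto
      also have "\<dots> \<le> L\<^sup>2 * (1 + t) * (1 + t)"
        using s(2)[of x] xy elim pos t(1)
        by (intro mult_mono add_left_mono)
           (auto simp: dist_norm pos_divide_le_eq intro: less_imp_le)
      finally show ?thesis
        using t(2) by simp
    qed
    then show ?case
      by (auto intro!: SUP_least)
  qed
  then show "linear_dilatation f z \<le> ereal (L\<^sup>2) + ereal e"
    unfolding linear_dilatation_def by (simp add: Limsup_bounded)
qed

theorem theorem10:
  fixes D :: "(real ^ 'n) set" and f :: "real ^ 'n \<Rightarrow> real ^ 'n" and L :: real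
  assumes "open D" and "D \<noteq> UNIV" and "frontier D \<noteq> {}"
    and "L \<ge> 1"
    and "\<exists>g. homeomorphism D (f ` D) f g"
    and "f ` D \<noteq> UNIV"
    and "sense_preserving_on D f"
    and "\<And>x y. x \<in> D \<Longrightarrow> y \<in> D \<Longrightarrow>
           c_tilde D x y / L \<le> c_tilde (f ` D) (f x) (f y) \<and>
           c_tilde (f ` D) (f x) (f y) \<le> L * c_tilde D x y"
  shows "quasiconformal_on D f \<and> (\<forall>z\<in>D. linear_dilatation f z \<le> ereal (L\<^sup>2))"
proof -
  obtain g where g: "homeomorphism D (f ` D) f g"
    using assms(5) by blast
  then have cont: "continuous_on D f" and inj: "inj_on f D"
    by (auto simp: homeomorphism_def intro: inj_on_inverseI)
  have op: "open (f ` D)"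
    using invariance_of_domain[OF cont assms(1) inj] .
  have "D \<noteq> {}"
    using assms(3) by auto
  \<comment> \<open>The space is connected, so only the empty set and the whole space have empty
    frontier.\<close>
  then have fr: "frontier (f ` D) \<noteq> {}"
    using assms(6) by (simp add: frontier_eq_empty)
  have "\<forall>z\<in>D. linear_dilatation f z \<le> ereal (L\<^sup>2)"
    using linear_dilatation_le[OF assms(1,3) op fr _ cont inj assms(8)] assms(4) by simp
  then show ?thesis
    unfolding quasiconformal_on_def using assms(5) by blast
qed

end
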